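(* Let $C\subset\mathbb P^2$ be a plane curve of degree $d$ through $O$, smooth at $O$, and let $D\subset\mathbb P^2$ be a line. Then $\Delta_{C,s_+}=\Delta_{d,\frac sd,\frac1d}$ for every rational $s\ge d^2$. In particular, for such $s$, $$\Delta_{(C,O)}(D)=\Delta_{\frac1d,d}=\begin{pmatrix}0&1\\1&-s\end{pmatrix}\Delta_{C,s_+},$$ where the matrix acts on column vectors $(t,u)^T$.
   Context: Work over $\mathbb C$; $x=X/Z$, $y=Y/Z$, $O=(0,0)$; $C$ tangent to $\{y=0\}$ at $O$, locally $x\mapsto(x,\xi(x))$, $\xi\in\mathbb C[[x]]$, $\xi(0)=\xi'(0)=0$. For $f\ne0$ with $C$-expansion $f=\sum a_{ij}x^i(y-\xi(x))^j$, $v_1(C,s;f)=\min\{i+sj:a_{ij}\ne0\}$ and, for rational $s$, $v_+(C,s)(f)=(v_1(C,s;f),\min\{j:\exists i,\ a_{ij}\ne0,\ i+sj=v_1(C,s;f)\})$. $\Delta_{C,s_+}\subset\mathbb R^2$ (coordinates $(t,u)$) is the closure of the convex hull of $\{v_+(C,s)(F/Z^k)/k:k\ge1,\ F\ne0\text{ homogeneous of degree }k\}$. $\Delta_{(C,O)}(D)$ is the Newton–Okounkov body of the line class with respect to the flag $\mathbb P^2\supset C\supset O$, i.e. built in the same way from the flag valuation $\nu(\phi)=(\operatorname{ord}_C\phi,\operatorname{ord}_O((\phi/g^{\operatorname{ord}_C\phi})|_C))$, $g$ a local equation of $C$ at $O$. $\Delta_{a,b,c}$ is the triangle with vertices $(0,0),(a,0),(b,c)$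 and $\Delta_{a,c}=\Delta_{a,0,c}$.
   Formalization: The plane curve C is assumed irreducible; for reducible C the claim fails, since Δ_{C,s+} depends only on the component through O (e.g. the pair of lines Y(Y−Z)=0 with d=2 gives the triangle for d=1). *)

theory Defs
  imports "HOL-Analysis.Analysis" "HOL-Computational_Algebra.Computational_Algebra"
begin

text \<open>Homogeneous polynomials in X, Y, Z over the complex numbers are represented as
  nested univariate polynomials: the outermost variable is X, then Y, innermost Z.
  hcoeff F a b c is the coefficient of X^a Y^b Z^c.\<close>

definition hcoeff :: "complex poly poly poly \<Rightarrow> nat \<Rightarrow> nat \<Rightarrow> nat \<Rightarrow> complex" where
  "hcoeff F a b c = coeff (coeff (coeff F a) b) c"

definition homogeneous_deg :: "complex poly poly poly \<Rightarrow> nat \<Rightarrow> bool" where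
  "homogeneous_deg F k \<longleftrightarrow> (\<forall>a b c. hcoeff F a b c \<noteq> 0 \<longrightarrow> a + b + c = k)"

text \<open>The dehomogenisation f = F(x,y,1), written in the local coordinates (x, w) with
  w = y - xi(x), as an element of C[[x,w]] = complex fps fps
  (outer variable w, inner variable x).  Its coefficient of x^i w^j is a_ij, the
  C-expansion coefficient.\<close>

definition cexp :: "complex fps \<Rightarrow> complex poly poly poly \<Rightarrow> complex fps fps" where
  "cexp \<xi> F = (\<Sum>a\<le>degree F. \<Sum>b\<le>degree (coeff F a).
      fps_const (fps_const (poly (coeff (coeff F a) b) 1) * fps_X ^ a)
        * (fps_X + fps_const \<xi>) ^ b)"

definition acoef :: "complex fps \<Rightarrow> complex poly poly poly \<Rightarrow> nat \<Rightarrow> nat \<Rightarrow> complex" where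
  "acoef \<xi> F i j = fps_nth (fps_nth (cexp \<xi> F) j) i"

definition v1 :: "complex fps \<Rightarrow> real \<Rightarrow> complex poly poly poly \<Rightarrow> real" where
  "v1 \<xi> s F = Inf {real i + s * real j | i j. acoef \<xi> F i j \<noteq> 0}"

definition vplus :: "complex fps \<Rightarrow> real \<Rightarrow> complex poly poly poly \<Rightarrow> real \<times> real" where
  "vplus \<xi> s F = (v1 \<xi> s F,
     Inf {real j | j. \<exists>i. acoef \<xi> F i j \<noteq> 0 \<and> real i + s * real j = v1 \<xi> s F})"

definition Delta_s_plus :: "complex fps \<Rightarrow> real \<Rightarrow> (real \<times> real) set" where
  "Delta_s_plus \<xi> s = closure (convex hull
     {(1 / real k) *\<^sub>R vplus \<xi> s F | k F. k \<ge> 1 \<and> F \<noteq> 0 \<and> homogeneous_deg F k})"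

text \<open>Flag valuation for the flag P^2 > C > O; G is a defining form of C, its
  dehomogenisation g = G(x,y,1) is the local equation of C at O.  All computations take
  place in C[[x,w]] (coordinates change y = w + xi(x)).\<close>

definition ord_C :: "complex fps \<Rightarrow> complex poly poly poly \<Rightarrow> complex poly poly poly \<Rightarrow> nat" where
  "ord_C \<xi> G F = (GREATEST m. cexp \<xi> G ^ m dvd cexp \<xi> F)"

definition flag_val :: "complex fps \<Rightarrow> complex poly poly poly \<Rightarrow> complex poly poly poly \<Rightarrow> real \<times> real" where
  "flag_val \<xi> G F = (let m = ord_C \<xi> G F;
      h = (SOME h. cexp \<xi> F = cexp \<xi> G ^ m * h)
    in (real m, real (subdegree (fps_nth h 0))))"

definition NO_body :: "complex fps \<Rightarrow> complex poly poly poly \<Rightarrow> (real \<times> real) set" where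
  "NO_body \<xi> G = closure (convex hull
     {(1 / real k) *\<^sub>R flag_val \<xi> G F | k F. k \<ge> 1 \<and> F \<noteq> 0 \<and> homogeneous_deg F k})"

definition tri :: "real \<Rightarrow> real \<Rightarrow> real \<Rightarrow> (real \<times> real) set" where
  "tri a b c = convex hull {(0, 0), (a, 0), (b, c)}"

end

theory Submission
  imports Defs "HOL-Computational_Algebra.Field_as_Ring" "Subresultants.More_Homomorphisms"
begin

text \<open>
  In the coordinates \<open>(x, w)\<close> the equation of the curve is \<open>w\<close> times a unit.  Write a form of
  degree \<open>k\<close> as \<open>F = G ^ m * H\<close> with \<open>G\<close> not dividing \<open>H\<close>; by Bezout \<open>H\<close> vanishes along the
  branch to order \<open>n \<le> d (k - m d)\<close>.  So \<open>x ^ n w ^ m\<close> is the lexicographically first term of the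
  expansion of \<open>F\<close>, and \<open>n + d\<^sup>2 m \<le> d k\<close>.  Since \<open>s \<ge> d\<^sup>2\<close>, the term that realises \<open>v\<^sub>+\<close>
  satisfies the same inequality.  Hence both valuations select a term \<open>x ^ i w ^ j\<close> of the expansion
  with \<open>i + d\<^sup>2 j \<le> d k\<close>, and in the coordinates \<open>(j, i)\<close> both bodies are the triangle with vertices
  \<open>(0, 0)\<close>, \<open>(1/d, 0)\<close>, \<open>(0, d)\<close>, once these are reached.  The form \<open>Z\<close> gives the first and \<open>G\<close> the
  second; the third is a limit, because the number of forms of degree \<open>k\<close> and the number of
  lattice points of the triangle agree up to \<open>O(k)\<close>.
\<close>

unbundle no vec_syntax
no_notation vec_index (infixl \<open>$\<close> 100)

subsection \<open>Dimension counts in vector spaces\<close>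

text \<open>
  Since \<open>dim\<close> is \<open>0\<close> for a subspace of infinite dimension, finiteness enters as \<open>U \<subseteq> span W\<close>
  for a finite \<open>W\<close>; the library assumes that the whole type has finite dimension.
\<close>

context vector_space
begin

lemma independent_subset_card_le_dim:
  assumes "independent B" "B \<subseteq> U" "U \<subseteq> span W" "finite W"
  shows "finite B" and "card B \<le> dim U"
proof -
  obtain C where C: "C \<subseteq> U" "independent C" "U \<subseteq> span C" "card C = dim U"
    by (rule basis_exists)
  have "finite C"
    using independent_span_bound[OF assms(4) C(2)] C(1) assms(3) by auto
  then show "finite B" and "card B \<le> dim U"
    using independent_span_bound[OF \<open>finite C\<close> assms(1)] C(3,4) assms(2) by auto
qed

lemma dim_mono_if_finite_span:
  assumes "S \<subseteq> U" "U \<subseteq> span W" "finite W"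
  shows "dim S \<le> dim U"
proof -
  obtain B where "B \<subseteq> S" "independent B" "card B = dim S"
    by (rule basis_exists)
  then show ?thesis
    using independent_subset_card_le_dim(2)[of B U W] assms by auto
qed

lemma dim_less_if_insert_subset:
  assumes "subspace S" "x \<notin> S" "insert x S \<subseteq> U" "U \<subseteq> span W" "finite W"
  shows "dim S < dim U"
proof -
  obtain B where B: "B \<subseteq> S" "independent B" "S \<subseteq> span B" "card B = dim S"
    by (rule basis_exists)
  have "x \<notin> span B"
    using span_minimal[OF B(1) assms(1)] assms(2) by blast
  then have "independent (insert x B)"
    using B(2) by (rule independent_insertI)
  moreover have "insert x B \<subseteq> U" using B(1) assms(3) by blast
  ultimately have "finite (insert x B)" "card (insert x B) \<le> dim U"
    by (rule independent_subset_card_le_dim[OF _ _ assms(4,5)])+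
  moreover have "x \<notin> B" using B(1) assms(2) by blast
  ultimately show ?thesis using B(4) by simp
qed

lemma independent_disjoint_UnI:
  assumes "finite X" "X \<subseteq> E - D" "D \<subseteq> E"
    and E: "independent E" and F: "independent F" and Int: "span E \<inter> span F \<subseteq> span D"
  shows "independent (F \<union> X) \<and> F \<inter> X = {}"
  using assms(1,2)
proof (induction X rule: finite_induct)
  case empty
  then show ?case using F by simp
next
  case (insert x X)
  have "x \<notin> span (F \<union> X)"
  proof
    assume "x \<in> span (F \<union> X)"
    then obtain a b where ab: "x = a + b" "a \<in> span F" "b \<in> span X"
      unfolding span_Un by blast
    have "x \<in> span E" "b \<in> span E"
      using ab(3) insert.prems span_mono[of X E] by (auto intro: span_base)
    then have "a \<in> span E"
      using span_diff[of x E b] ab(1) by simp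
    then have "a \<in> span D" using ab(2) Int by blast
    then have "x \<in> span (D \<union> X)"
      using ab unfolding span_Un by blast
    moreover have "D \<union> X \<subseteq> E - {x}"
      using insert.prems insert.hyps(2) \<open>D \<subseteq> E\<close> by blast
    ultimately have "x \<in> span (E - {x})" using span_mono by blast
    with E insert.prems show False by (auto simp: dependent_def)
  qed
  moreover from this have "x \<notin> F" by (auto intro: span_base)
  ultimately show ?case
    using insert.IH insert.prems independent_insertI by auto
qed

lemma dim_add_le_dim_add_dim_Int:
  assumes S: "subspace S" "S \<subseteq> U" and T: "subspace T" "T \<subseteq> U" and U: "U \<subseteq> span W" "finite W"
  shows "dim S + dim T \<le> dim U + dim (S \<inter> T)"
proof -
  obtain D where D: "D \<subseteq> S \<inter> T" "independent D" "S \<inter> T \<subseteq> span D" "card D = dim (S \<inter> T)"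
    by (rule basis_exists)
  obtain E where E: "D \<subseteq> E" "E \<subseteq> S" "independent E" "S \<subseteq> span E"
    using maximal_independent_subset_extend[of D S] D by auto
  obtain F where F: "F \<subseteq> T" "independent F" "T \<subseteq> span F"
    by (rule maximal_independent_subset)
  have "finite E" "finite F"
    using independent_subset_card_le_dim(1)[OF _ _ U] E(2,3) F(1,2) S(2) T(2) by auto
  have Int: "span E \<inter> span F \<subseteq> span D"
    using D(3) span_minimal[OF E(2) S(1)] span_minimal[OF F(1) T(1)] by blast
  have union: "independent (F \<union> (E - D)) \<and> F \<inter> (E - D) = {}"
    using independent_disjoint_UnI[OF _ _ E(1,3) F(2) Int] \<open>finite E\<close> by blast
  then have "card (F \<union> (E - D)) \<le> dim U"
    using independent_subset_card_le_dim(2)[OF _ _ U] E(2) F(1) S(2) T(2) by blast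
  with union have "card F + (card E - card D) \<le> dim U"
    using \<open>finite E\<close> \<open>finite F\<close> E(1) by (simp add: card_Un_disjoint card_Diff_subset finite_subset)
  moreover have "card E = dim S" "card F = dim T"
    using basis_card_eq_dim E(2-4) F by auto
  ultimately show ?thesis using D(4) by linarith
qed

lemma dim_le_dim_kernel_add_1:
  assumes "subspace U" "U \<subseteq> span W" "finite W" and f: "Vector_Spaces.linear scale (*) f"
  shows "dim U \<le> dim {x \<in> U. f x = 0} + 1"
proof -
  interpret f: Vector_Spaces.linear scale "(*)" f by (fact f)
  let ?K = "{x \<in> U. f x = 0}"
  obtain B where B: "B \<subseteq> ?K" "independent B" "?K \<subseteq> span B" "card B = dim ?K"
    by (rule basis_exists)
  have "finite B"
    using independent_subset_card_le_dim(1)[OF B(2) _ assms(2,3)] B(1) by blast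
  obtain p where "U \<subseteq> span (insert p B)"
  proof (cases "?K = U")
    case True
    then show ?thesis using that[of 0] B(3) span_mono[of B "insert 0 B"] by blast
  next
    case False
    then obtain p where p: "p \<in> U" "f p \<noteq> 0" by blast
    have "x \<in> span (insert p B)" if "x \<in> U" for x
    proof -
      have "x - scale (f x / f p) p \<in> ?K"
        using p that \<open>subspace U\<close> by (auto simp: f.diff f.scale subspace_diff subspace_scale)
      then show ?thesis
        using B(3) unfolding span_breakdown_eq by blast
    qed
    then show ?thesis using that by blast
  qed
  then have "dim U \<le> card (insert p B)"
    using \<open>finite B\<close> by (intro dim_le_card) auto
  also have "\<dots> \<le> dim ?K + 1"
    using \<open>finite B\<close> B(4) by (simp add: card_insert_if)
  finally show ?thesis .
qed

lemma subspace_common_kernel: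
  assumes "subspace U" "\<And>j. j \<in> J \<Longrightarrow> Vector_Spaces.linear scale (*) (f j)"
  shows "subspace {x \<in> U. \<forall>j\<in>J. f j x = 0}"
proof -
  have "subspace (U \<inter> (\<Inter>j\<in>J. {x. f j x = 0}))"
    using assms by (intro subspace_inter subspace_Int module_hom.subspace_kernel)
      (auto simp: Vector_Spaces.linear_def)
  also have "U \<inter> (\<Inter>j\<in>J. {x. f j x = 0}) = {x \<in> U. \<forall>j\<in>J. f j x = 0}"
    by blast
  finally show ?thesis .
qed

lemma dim_le_dim_common_kernel_add_card:
  assumes "finite J" "\<And>j. j \<in> J \<Longrightarrow> Vector_Spaces.linear scale (*) (f j)"
    and U: "subspace U" "U \<subseteq> span W" "finite W"
  shows "dim U \<le> dim {x \<in> U. \<forall>j\<in>J. f j x = 0} + card J"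
  using assms(1,2)
proof (induction J rule: finite_induct)
  case (insert j J)
  let ?K = "{x \<in> U. \<forall>j\<in>J. f j x = 0}"
  have "subspace ?K"
    using U(1) insert.prems by (intro subspace_common_kernel) auto
  then have "dim ?K \<le> dim {x \<in> ?K. f j x = 0} + 1"
    using dim_le_dim_kernel_add_1[of ?K W "f j"] U insert.prems by auto
  moreover have "{x \<in> ?K. f j x = 0} = {x \<in> U. \<forall>j\<in>insert j J. f j x = 0}"
    by blast
  ultimately show ?case using insert by simp
qed simp

corollary exists_common_zero:
  assumes "finite J" "\<And>j. j \<in> J \<Longrightarrow> Vector_Spaces.linear scale (*) (f j)"
    and "subspace U" "U \<subseteq> span W" "finite W" and "card J < dim U"
  obtains x where "x \<in> U" "x \<noteq> 0" "\<And>j. j \<in> J \<Longrightarrow> f j x = 0"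
proof -
  let ?K = "{x \<in> U. \<forall>j\<in>J. f j x = 0}"
  have "dim ?K > 0"
    using dim_le_dim_common_kernel_add_card[of J f U W] assms by simp
  then have "\<not> ?K \<subseteq> {0}"
    using dim_le_card[of ?K "{}"] by force
  then show ?thesis using that by blast
qed

end

lemma (in vector_space_pair) dim_injective_linear_image:
  assumes "Vector_Spaces.linear s1 s2 f" "inj_on f (vs1.span S)"
  shows "vs2.dim (f ` S) = vs1.dim S"
proof -
  obtain B where B: "B \<subseteq> S" "vs1.independent B" "S \<subseteq> vs1.span B" "card B = vs1.dim S"
    by (rule vs1.basis_exists)
  have inj: "inj_on f (vs1.span B)"
    using assms(2) vs1.span_mono[OF B(1)] by (rule inj_on_subset)
  have "vs2.independent (f ` B)"
    by (rule linear_independent_injective_image[OF assms(1) B(2) inj])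
  moreover have "f ` S \<subseteq> vs2.span (f ` B)"
    using B(3) by (auto simp: linear_span_image[OF assms(1)])
  moreover have "card (f ` B) = vs1.dim S"
    using B(4) card_image inj_on_subset[OF inj vs1.span_superset] by metis
  ultimately show ?thesis
    using B(1) by (intro vs2.dim_unique[of "f ` B"]) auto
qed

subsection \<open>The expansion along a branch\<close>

lemma (in comm_ring_hom) comm_ring_hom_eval_poly: "comm_ring_hom (\<lambda>p. eval_poly hom p x)"
proof -
  interpret map_poly: map_poly_comm_ring_hom hom ..
  show ?thesis
    by unfold_locales (simp_all add: eval_poly_def map_poly.hom_add map_poly.hom_mult)
qed

lemma cexp_eq_eval_poly:
  "cexp \<xi> F =
    eval_poly (\<lambda>p. eval_poly (\<lambda>q. fps_const (fps_const (poly q 1))) p (fps_X + fps_const \<xi>))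
      F (fps_const fps_X)"
  by (auto simp: cexp_def eval_poly_as_sum sum_distrib_left mult_ac
      simp flip: fps_const_mult intro!: sum.cong)

lemma comm_ring_hom_cexp: "comm_ring_hom (cexp \<xi>)"
proof -
  have "comm_ring_hom (\<lambda>q :: complex poly. fps_const (fps_const (poly q 1)))"
    by unfold_locales simp_all
  then show ?thesis
    unfolding cexp_eq_eval_poly[abs_def] by (intro comm_ring_hom.comm_ring_hom_eval_poly)
qed

interpretation cexp: comm_ring_hom "cexp \<xi>" for \<xi>
  by (rule comm_ring_hom_cexp)

definition restrict_to_branch :: "complex fps \<Rightarrow> complex poly poly poly \<Rightarrow> complex fps" where
  "restrict_to_branch \<xi> F = cexp \<xi> F $ 0"

interpretation restrict_to_branch: comm_ring_hom "restrict_to_branch \<xi>" for \<xi>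
  by unfold_locales (simp_all add: restrict_to_branch_def cexp.hom_add cexp.hom_mult)

lemma nth_shifted_power_nth_0:
  fixes \<xi> :: "'a::comm_ring_1 fps"
  assumes "\<xi> $ 0 = 0"
  shows "(fps_X + fps_const \<xi>) ^ b $ j $ 0 = (if b = j then 1 else 0)"
proof (induction b arbitrary: j)
  case (Suc b)
  then show ?case using assms by (cases j) (auto simp: distrib_right)
qed auto

lemma acoef_0_left:
  assumes "\<xi> $ 0 = 0"
  shows "acoef \<xi> F 0 j = poly (coeff (coeff F 0) j) 1"
proof -
  let ?q = "\<lambda>a b. poly (coeff (coeff F a) b) 1"
  have "acoef \<xi> F 0 j = (\<Sum>a\<le>degree F. \<Sum>b\<le>degree (coeff F a). if a = 0 \<and> b = j then ?q a b else 0)"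
    unfolding acoef_def cexp_def fps_sum_nth fps_mult_left_const_nth
    by (intro sum.cong) (auto simp: nth_shifted_power_nth_0[OF assms])
  also have "\<dots> = (\<Sum>b\<le>degree (coeff F 0). if b = j then ?q 0 j else 0)"
    by (subst sum.remove[of _ 0]) (auto intro!: sum.neutral sum.cong)
  also have "\<dots> = ?q 0 j" by (auto simp: coeff_eq_0)
  finally show ?thesis .
qed

subsection \<open>Lattice points of right triangles\<close>

definition lattice_triangle :: "nat \<Rightarrow> nat \<Rightarrow> (nat \<times> nat) set" where
  "lattice_triangle D q = {(i, j). i + D * j \<le> D * q}"

lemma lattice_triangle_eq_image_Sigma:
  assumes "D \<ge> 1"
  shows "lattice_triangle D q = prod.swap ` (SIGMA j:{..q}. {..D * (q - j)})"
proof -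
  have "i + D * j \<le> D * q \<longleftrightarrow> j \<le> q \<and> i \<le> D * (q - j)" for i j
  proof (cases "j \<le> q")
    case True
    then show ?thesis by (auto simp: diff_mult_distrib2 le_diff_conv2)
  next
    case False
    then have "D * q < D * j" using assms by simp
    with False show ?thesis by linarith
  qed
  then show ?thesis by (auto simp: lattice_triangle_def image_iff)
qed

lemma finite_lattice_triangle: "D \<ge> 1 \<Longrightarrow> finite (lattice_triangle D q)"
  by (simp add: lattice_triangle_eq_image_Sigma)

lemma card_lattice_triangle:
  assumes "D \<ge> 1"
  shows "2 * card (lattice_triangle D q) = (q + 1) * (D * q + 2)"
proof -
  have "card (lattice_triangle D q) = (\<Sum>j\<le>q. Suc (D * (q - j)))"
    by (simp add: lattice_triangle_eq_image_Sigma[OF assms] card_image)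
  also have "\<dots> = (\<Sum>j\<le>q. Suc (D * j))"
    using sum.nat_diff_reindex[of "\<lambda>j. Suc (D * j)" "Suc q"] by (simp add: lessThan_Suc_atMost)
  also have "2 * \<dots> = (q + 1) * (D * q + 2)"
    by (induction q) (auto simp: algebra_simps)
  finally show ?thesis .
qed

lemma card_lattice_triangle_without_corner:
  assumes "D \<ge> 1" "t \<le> q"
  shows "card {(i, j) \<in> lattice_triangle D q. i + D * t < D * q} + card (lattice_triangle D t) =
    card (lattice_triangle D q)"
proof -
  let ?A = "{(i, j) \<in> lattice_triangle D q. i + D * t < D * q}"
  let ?shift = "\<lambda>(i, j). (i + D * (q - t), j)"
  have D_q: "D * (q - t) + D * t = D * q" using assms(2) by (simp flip: distrib_left)
  have "lattice_triangle D q = ?A \<union> ?shift ` lattice_triangle D t"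
  proof (intro equalityI subsetI)
    fix p assume p: "p \<in> lattice_triangle D q"
    obtain i j where ij: "p = (i, j)" by force
    show "p \<in> ?A \<union> ?shift ` lattice_triangle D t"
    proof (cases "p \<in> ?A")
      case False
      then have "D * (q - t) \<le> i" using p D_q by (simp add: ij)
      then have "(i - D * (q - t), j) \<in> lattice_triangle D t" "p = ?shift (i - D * (q - t), j)"
        using p D_q by (simp_all add: ij lattice_triangle_def)
      then show ?thesis by blast
    qed simp
  qed (use D_q in \<open>auto simp: lattice_triangle_def\<close>)
  moreover have "?A \<inter> ?shift ` lattice_triangle D t = {}"
    using D_q by auto
  moreover have "finite ?A"
    by (rule finite_subset[OF _ finite_lattice_triangle[OF assms(1), of q]]) blast
  moreover have "inj_on ?shift (lattice_triangle D t)"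
    by (auto simp: inj_on_def)
  ultimately show ?thesis
    using finite_lattice_triangle[OF assms(1), of t]
    by (metis (no_types, lifting) card_Un_disjoint card_image finite_imageI)
qed

subsection \<open>The vector space of ternary forms\<close>

lemma hcoeff_eqI: "(\<And>a b c. hcoeff F a b c = hcoeff H a b c) \<Longrightarrow> F = H"
  by (simp add: hcoeff_def poly_eq_iff)

lemma hcoeff_0 [simp]: "hcoeff 0 a b c = 0"
  by (simp add: hcoeff_def)

lemma hcoeff_add [simp]: "hcoeff (F + H) a b c = hcoeff F a b c + hcoeff H a b c"
  by (simp add: hcoeff_def)

lemma hcoeff_sum: "hcoeff (\<Sum>i\<in>A. f i) a b c = (\<Sum>i\<in>A. hcoeff (f i) a b c)"
  by (simp add: hcoeff_def coeff_sum)

lemma hcoeff_mult: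
  "hcoeff (F * H) a b c =
    (\<Sum>i\<le>a. \<Sum>j\<le>b. \<Sum>l\<le>c. hcoeff F i j l * hcoeff H (a - i) (b - j) (c - l))"
  by (simp add: hcoeff_def coeff_mult coeff_sum)

definition scale_form :: "complex \<Rightarrow> complex poly poly poly \<Rightarrow> complex poly poly poly" where
  "scale_form z F = [:[:[:z:]:]:] * F"

lemma hcoeff_scale_form [simp]: "hcoeff (scale_form z F) a b c = z * hcoeff F a b c"
  by (simp add: hcoeff_def scale_form_def)

lemma cexp_scale_form: "cexp \<xi> (scale_form z F) = fps_const (fps_const z) * cexp \<xi> F"
  unfolding scale_form_def cexp.hom_mult by (simp add: cexp_def)

interpretation form: vector_space scale_form
  by unfold_locales (auto intro!: hcoeff_eqI simp: algebra_simps)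

interpretation form_pair: vector_space_pair scale_form scale_form ..

lemma linear_mult_form: "Vector_Spaces.linear scale_form scale_form ((*) G)"
  by unfold_locales (simp_all add: distrib_left scale_form_def)

lemma linear_acoef: "Vector_Spaces.linear scale_form (*) (\<lambda>F. acoef \<xi> F i j)"
  by unfold_locales (simp_all add: acoef_def cexp.hom_add cexp_scale_form)

definition hmonom :: "nat \<Rightarrow> nat \<Rightarrow> nat \<Rightarrow> complex poly poly poly" where
  "hmonom a b c = monom (monom (monom 1 c) b) a"

lemma hcoeff_hmonom: "hcoeff (hmonom a b c) i j l = (if a = i \<and> b = j \<and> c = l then 1 else 0)"
  by (simp add: hcoeff_def hmonom_def)

lemma cexp_hmonom: "cexp \<xi> (hmonom a b c) = fps_const (fps_X ^ a) * (fps_X + fps_const \<xi>) ^ b"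
  by (simp add: cexp_eq_eval_poly eval_poly_def hmonom_def map_poly_monom poly_monom
      mult.commute)

lemma restrict_to_branch_hmonom: "restrict_to_branch \<xi> (hmonom a b c) = fps_X ^ a * \<xi> ^ b"
  by (simp add: restrict_to_branch_def cexp_hmonom fps_power_zeroth)

definition forms :: "nat \<Rightarrow> complex poly poly poly set" where
  "forms k = {F. homogeneous_deg F k}"

lemma forms_iff: "F \<in> forms k \<longleftrightarrow> (\<forall>a b c. hcoeff F a b c \<noteq> 0 \<longrightarrow> a + b + c = k)"
  by (simp add: forms_def homogeneous_deg_def)

lemma hcoeff_eq_0_if_forms: "F \<in> forms k \<Longrightarrow> a + b + c \<noteq> k \<Longrightarrow> hcoeff F a b c = 0"
  by (auto simp: forms_iff)

lemma hmonom_in_forms: "a + b + c = k \<Longrightarrow> hmonom a b c \<in> forms k"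
  by (auto simp: forms_iff hcoeff_hmonom split: if_splits)

lemma subspace_forms: "form.subspace (forms k)"
proof (rule form.subspaceI)
  fix F H assume "F \<in> forms k" "H \<in> forms k"
  then show "F + H \<in> forms k"
    unfolding forms_iff hcoeff_add by (metis add_0)
qed (auto simp: forms_iff)

lemma mult_in_forms:
  assumes "F \<in> forms k" "H \<in> forms l"
  shows "F * H \<in> forms (k + l)"
  unfolding forms_iff
proof (intro allI impI)
  fix a b c assume "hcoeff (F * H) a b c \<noteq> 0"
  then obtain i j m where ijm: "i \<le> a" "j \<le> b" "m \<le> c"
      "hcoeff F i j m * hcoeff H (a - i) (b - j) (c - m) \<noteq> 0"
    unfolding hcoeff_mult
    by (metis (no_types, lifting) atMost_iff sum.not_neutral_contains_not_neutral)
  then have "i + j + m = k" "(a - i) + (b - j) + (c - m) = l"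
    using assms unfolding forms_iff by (metis mult_zero_left, metis mult_zero_right)
  with ijm show "a + b + c = k + l" by linarith
qed

lemma power_in_forms: "F \<in> forms d \<Longrightarrow> F ^ m \<in> forms (m * d)"
proof (induction m)
  case 0
  have "1 = hmonom 0 0 0" by (simp add: hmonom_def monom_0)
  then show ?case using hmonom_in_forms[of 0 0 0 0] by simp
next
  case (Suc m)
  then show ?case using mult_in_forms[of F d "F ^ m" "m * d"] by simp
qed

definition monomial_of_degree :: "nat \<Rightarrow> nat \<times> nat \<Rightarrow> complex poly poly poly" where
  "monomial_of_degree k = (\<lambda>(a, b). hmonom a b (k - a - b))"

definition monomial_basis :: "nat \<Rightarrow> complex poly poly poly set" where
  "monomial_basis k = monomial_of_degree k ` lattice_triangle 1 k"

lemma hcoeff_monomial_of_degree: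
  assumes "p \<in> lattice_triangle 1 k"
  shows "hcoeff (monomial_of_degree k p) a b c = (if p = (a, b) \<and> a + b + c = k then 1 else 0)"
  using assms
  by (cases p) (auto simp: monomial_of_degree_def hcoeff_hmonom lattice_triangle_def)

lemma hcoeff_sum_monomial_of_degree:
  "hcoeff (\<Sum>p\<in>lattice_triangle 1 k. scale_form (f p) (monomial_of_degree k p)) a b c =
    (if a + b + c = k then f (a, b) else 0)"
proof -
  have "hcoeff (\<Sum>p\<in>lattice_triangle 1 k. scale_form (f p) (monomial_of_degree k p)) a b c
      = (\<Sum>p\<in>lattice_triangle 1 k. if p = (a, b) then if a + b + c = k then f (a, b) else 0 else 0)"
    unfolding hcoeff_sum by (intro sum.cong) (simp_all add: hcoeff_monomial_of_degree)
  then show ?thesis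
    by (auto simp: finite_lattice_triangle) (simp add: lattice_triangle_def)
qed

definition hcomponent :: "nat \<Rightarrow> complex poly poly poly \<Rightarrow> complex poly poly poly" where
  "hcomponent k F = (\<Sum>p\<in>lattice_triangle 1 k.
     scale_form (hcoeff F (fst p) (snd p) (k - fst p - snd p)) (monomial_of_degree k p))"

lemma hcoeff_hcomponent:
  "hcoeff (hcomponent k F) a b c = (if a + b + c = k then hcoeff F a b c else 0)"
  unfolding hcomponent_def hcoeff_sum_monomial_of_degree by auto

lemma hcomponent_in_forms: "hcomponent k F \<in> forms k"
  by (auto simp: forms_iff hcoeff_hcomponent split: if_splits)

lemma hcomponent_eq_self: "F \<in> forms k \<Longrightarrow> hcomponent k F = F"
  by (auto intro!: hcoeff_eqI simp: hcoeff_hcomponent hcoeff_eq_0_if_forms)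

lemma finite_monomial_basis: "finite (monomial_basis k)"
  by (simp add: monomial_basis_def finite_lattice_triangle)

lemma inj_on_monomial_of_degree: "inj_on (monomial_of_degree k) (lattice_triangle 1 k)"
proof (rule inj_onI)
  fix p p' assume p: "p \<in> lattice_triangle 1 k" "p' \<in> lattice_triangle 1 k"
    and eq: "monomial_of_degree k p = monomial_of_degree k p'"
  obtain a b where ab: "p = (a, b)" by force
  have "hcoeff (monomial_of_degree k p') a b (k - a - b) = 1"
    using p(1) hcoeff_monomial_of_degree[OF p(1)] by (simp add: ab lattice_triangle_def flip: eq)
  then show "p = p'"
    using hcoeff_monomial_of_degree[OF p(2)] by (simp add: ab split: if_splits)
qed

lemma span_monomial_basis: "form.span (monomial_basis k) = forms k"
proof
  show "form.span (monomial_basis k) \<subseteq> forms k"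
    by (rule form.span_minimal[OF _ subspace_forms])
      (auto simp: monomial_basis_def monomial_of_degree_def lattice_triangle_def
        intro!: hmonom_in_forms)
  have "hcomponent k F \<in> form.span (monomial_basis k)" for F
    unfolding hcomponent_def monomial_basis_def
    by (intro form.span_sum form.span_scale form.span_base imageI)
  then show "forms k \<subseteq> form.span (monomial_basis k)"
    by (metis hcomponent_eq_self subsetI)
qed

lemma independent_monomial_basis: "form.independent (monomial_basis k)"
proof (rule form.independent_if_scalars_zero[OF finite_monomial_basis])
  fix f m assume sum: "(\<Sum>m\<in>monomial_basis k. scale_form (f m) m) = 0" and "m \<in> monomial_basis k"
  then obtain a b where m: "m = monomial_of_degree k (a, b)" "a + b \<le> k"
    by (auto simp: monomial_basis_def lattice_triangle_def)
  let ?c = "\<lambda>p. f (monomial_of_degree k p)"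
  have "(\<Sum>p\<in>lattice_triangle 1 k. scale_form (?c p) (monomial_of_degree k p)) = 0"
    using sum unfolding monomial_basis_def sum.reindex[OF inj_on_monomial_of_degree] by simp
  then have "?c (a, b) = hcoeff 0 a b (k - a - b)"
    using hcoeff_sum_monomial_of_degree[of ?c k a b "k - a - b"] m(2) by simp
  then show "f m = 0" by (simp add: m(1))
qed

lemma dim_forms: "2 * form.dim (forms k) = (k + 1) * (k + 2)"
proof -
  have "form.dim (forms k) = card (monomial_basis k)"
    using form.dim_span_eq_card_independent[OF independent_monomial_basis, of k]
    by (simp add: span_monomial_basis)
  also have "\<dots> = card (lattice_triangle 1 k)"
    unfolding monomial_basis_def by (rule card_image[OF inj_on_monomial_of_degree])
  finally show ?thesis using card_lattice_triangle[of 1 k] by simp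
qed

lemma dim_mult_forms:
  assumes "G \<noteq> 0"
  shows "form.dim ((*) G ` forms k) = form.dim (forms k)"
  using assms
  by (intro form_pair.dim_injective_linear_image linear_mult_form) (auto simp: inj_on_def)

lemma hcoeff_mult_cong:
  assumes "G \<in> forms d"
    and "\<And>i j l. i + j + l + d = a + b + c \<Longrightarrow> hcoeff H i j l = hcoeff K i j l"
  shows "hcoeff (G * H) a b c = hcoeff (G * K) a b c"
  unfolding hcoeff_mult
proof (intro sum.cong refl)
  fix i j l assume "i \<in> {..a}" "j \<in> {..b}" "l \<in> {..c}"
  then show "hcoeff G i j l * hcoeff H (a - i) (b - j) (c - l) =
      hcoeff G i j l * hcoeff K (a - i) (b - j) (c - l)"
    using assms(2)[of "a - i" "b - j" "c - l"] hcoeff_eq_0_if_forms[OF assms(1), of i j l]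
    by (cases "i + j + l = d") auto
qed

lemma hcomponent_mult:
  assumes "G \<in> forms d" "d \<le> k"
  shows "hcomponent k (G * H) = G * hcomponent (k - d) H"
proof (rule hcoeff_eqI)
  fix a b c
  show "hcoeff (hcomponent k (G * H)) a b c = hcoeff (G * hcomponent (k - d) H) a b c"
  proof (cases "a + b + c = k")
    case True
    then show ?thesis
      by (auto simp: hcoeff_hcomponent intro!: hcoeff_mult_cong[OF assms(1)])
  next
    case False
    moreover have "G * hcomponent (k - d) H \<in> forms k"
      using mult_in_forms[OF assms(1) hcomponent_in_forms] assms(2) by (metis le_add_diff_inverse)
    ultimately show ?thesis
      by (simp add: hcoeff_hcomponent hcoeff_eq_0_if_forms)
  qed
qed

lemma cofactor_in_forms:
  assumes GH: "G * H \<in> forms k" "G * H \<noteq> 0" and G: "G \<in> forms d"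
  shows "d \<le> k" and "H \<in> forms (k - d)"
proof -
  show "d \<le> k"
  proof (rule ccontr)
    assume "\<not> d \<le> k"
    have "hcoeff (G * H) a b c = 0" for a b c
    proof (cases "a + b + c = k")
      case True
      then have "hcoeff (G * H) a b c = hcoeff (G * 0) a b c"
        using \<open>\<not> d \<le> k\<close> by (intro hcoeff_mult_cong[OF G]) auto
      then show ?thesis by simp
    qed (rule hcoeff_eq_0_if_forms[OF GH(1)])
    then have "G * H = 0" by (intro hcoeff_eqI) simp
    with GH(2) show False by simp
  qed
  then have "G * H = G * hcomponent (k - d) H"
    using hcomponent_mult[OF G] hcomponent_eq_self[OF GH(1)] by metis
  then show "H \<in> forms (k - d)"
    using GH(2) hcomponent_in_forms by (metis mult_cancel_left mult_zero_left)
qed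

subsection \<open>Intersection multiplicity with a branch\<close>

definition vanishing_forms :: "complex fps \<Rightarrow> nat \<Rightarrow> nat \<Rightarrow> complex poly poly poly set" where
  "vanishing_forms \<xi> k n = {F \<in> forms k. \<forall>i\<in>{..<n}. acoef \<xi> F i 0 = 0}"

lemma acoef_0_right: "acoef \<xi> F i 0 = restrict_to_branch \<xi> F $ i"
  by (simp add: acoef_def restrict_to_branch_def)

lemma subspace_vanishing_forms: "form.subspace (vanishing_forms \<xi> k n)"
  unfolding vanishing_forms_def
  by (intro form.subspace_common_kernel subspace_forms linear_acoef)

lemma dim_vanishing_forms_le:
  "n \<le> Suc k \<Longrightarrow> form.dim (vanishing_forms \<xi> k n) + n \<le> form.dim (forms k)"
proof (induction n)
  case 0
  then show ?case by (simp add: vanishing_forms_def)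
next
  case (Suc n)
  define P where "P = hmonom n 0 (k - n)"
  have P: "P \<in> forms k" "restrict_to_branch \<xi> P = fps_X ^ n"
    using Suc.prems by (simp_all add: P_def hmonom_in_forms restrict_to_branch_hmonom)
  then have "P \<notin> vanishing_forms \<xi> k (Suc n)"
    "insert P (vanishing_forms \<xi> k (Suc n)) \<subseteq> vanishing_forms \<xi> k n"
    by (auto simp: vanishing_forms_def acoef_0_right)
  moreover have "vanishing_forms \<xi> k n \<subseteq> form.span (monomial_basis k)"
    by (auto simp: span_monomial_basis vanishing_forms_def)
  ultimately have "form.dim (vanishing_forms \<xi> k (Suc n)) < form.dim (vanishing_forms \<xi> k n)"
    using form.dim_less_if_insert_subset[OF subspace_vanishing_forms _ _ _ finite_monomial_basis]
    by blast
  with Suc show ?case by simp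
qed

lemma multiples_Int_subset:
  assumes "prime_elem G" "\<not> G dvd H" "G \<in> forms d"
  shows "(*) G ` forms l \<inter> (*) H ` forms (m + d) \<subseteq> (*) (G * H) ` forms m"
proof
  fix F assume "F \<in> (*) G ` forms l \<inter> (*) H ` forms (m + d)"
  then obtain P Q where F: "F = G * P" "F = H * Q" and Q: "Q \<in> forms (m + d)" by blast
  have "G dvd H * Q" using F by (metis dvd_triv_left)
  then obtain R where R: "Q = G * R"
    using assms(1,2) by (auto simp: prime_elem_dvd_mult_iff)
  have "R \<in> forms m"
  proof (cases "R = 0")
    case True
    then show ?thesis by (simp add: form.subspace_0 subspace_forms)
  next
    case False
    then have "G * R \<noteq> 0" using assms(1) by auto
    then show ?thesis using cofactor_in_forms(2)[of G R "m + d" d] Q R assms(3) by simp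
  qed
  then show "F \<in> (*) (G * H) ` forms m" using F(2) R by (auto simp: mult_ac)
qed

lemma dim_add_le_if_contains_multiples:
  assumes G: "prime_elem G" "G \<in> forms d" and "\<not> G dvd H"
    and S: "form.subspace S" "S \<subseteq> forms k"
    and multiples: "(*) G ` forms (m + e) \<subseteq> S" "(*) H ` forms (m + d) \<subseteq> S"
  shows "form.dim (forms (m + e)) + form.dim (forms (m + d)) \<le> form.dim S + form.dim (forms m)"
proof -
  have nz: "G \<noteq> 0" "H \<noteq> 0" using assms by auto
  have "form.dim (forms (m + e)) + form.dim (forms (m + d)) =
      form.dim ((*) G ` forms (m + e)) + form.dim ((*) H ` forms (m + d))"
    by (simp add: dim_mult_forms nz)
  also have "\<dots> \<le> form.dim S + form.dim ((*) G ` forms (m + e) \<inter> (*) H ` forms (m + d))"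
    using multiples S(2)
    by (intro form.dim_add_le_dim_add_dim_Int[of _ _ _ "monomial_basis k"] finite_monomial_basis
        form_pair.linear_subspace_image[OF linear_mult_form subspace_forms])
      (simp_all add: span_monomial_basis)
  also have "form.dim ((*) G ` forms (m + e) \<inter> (*) H ` forms (m + d)) \<le>
      form.dim ((*) (G * H) ` forms m)"
    using multiples_Int_subset[OF G(1) assms(3) G(2)]
    by (intro form.dim_mono_if_finite_span[of _ _ "(*) (G * H) ` monomial_basis m"])
      (simp_all add: finite_monomial_basis form_pair.linear_span_image[OF linear_mult_form]
        span_monomial_basis)
  also have "form.dim ((*) (G * H) ` forms m) = form.dim (forms m)"
    by (rule dim_mult_forms) (simp add: nz)
  finally show ?thesis by simp
qed

text \<open>
  Linear algebra replaces Bezout's theorem: in high degree the multiples of \<open>G\<close> and \<open>H\<close> span a space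
  of codimension \<open>d e\<close>, whereas vanishing along the branch to order \<open>n\<close> has codimension \<open>n\<close>.
\<close>

lemma branch_vanishing_order_le:
  assumes G: "prime_elem G" "G \<in> forms d" "restrict_to_branch \<xi> G = 0"
    and H: "H \<in> forms e" "\<not> G dvd H" "\<And>i. i < n \<Longrightarrow> restrict_to_branch \<xi> H $ i = 0"
  shows "n \<le> d * e"
proof -
  define S where "S = vanishing_forms \<xi> (n + d + e) n"
  have "G * F \<in> S" if "F \<in> forms (n + e)" for F
    using mult_in_forms[OF G(2) that] G(3)
    by (simp add: S_def vanishing_forms_def acoef_0_right restrict_to_branch.hom_mult ac_simps)
  moreover have "H * F \<in> S" if "F \<in> forms (n + d)" for F
    using mult_in_forms[OF H(1) that] H(3)
    by (simp add: S_def vanishing_forms_def acoef_0_right restrict_to_branch.hom_mult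
        fps_mult_nth ac_simps)
  ultimately have "form.dim (forms (n + e)) + form.dim (forms (n + d)) \<le>
      form.dim S + form.dim (forms n)"
    using subspace_vanishing_forms
    by (intro dim_add_le_if_contains_multiples[OF G(1,2) H(2), of _ "n + d + e"])
      (auto simp: S_def vanishing_forms_def)
  moreover have "form.dim S + n \<le> form.dim (forms (n + d + e))"
    unfolding S_def by (rule dim_vanishing_forms_le) simp
  ultimately have "2 * form.dim (forms (n + e)) + 2 * form.dim (forms (n + d)) + 2 * n \<le>
      2 * form.dim (forms (n + d + e)) + 2 * form.dim (forms n)"
    by simp
  then show ?thesis
    unfolding dim_forms by (simp add: algebra_simps)
qed

corollary branch_multiplicity_le:
  assumes "prime_elem G" "G \<in> forms d" "restrict_to_branch \<xi> G = 0"
    and "H \<in> forms e" "\<not> G dvd H"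
  shows "restrict_to_branch \<xi> H \<noteq> 0" and "subdegree (restrict_to_branch \<xi> H) \<le> d * e"
proof -
  show "restrict_to_branch \<xi> H \<noteq> 0"
    using branch_vanishing_order_le[OF assms, of "Suc (d * e)"] by auto
  show "subdegree (restrict_to_branch \<xi> H) \<le> d * e"
    using branch_vanishing_order_le[OF assms] nth_less_subdegree_zero by blast
qed

subsection \<open>Forms with expansion supported near a vertex\<close>

text \<open>
  For \<open>k = d t\<^sup>2\<close> the triangle \<open>i + d\<^sup>2 j \<le> d k\<close> has at most \<open>d\<^sup>2 t\<^sup>2 / 2\<close> lattice points more than
  there are monomials of degree \<open>k\<close>, fewer than lie in its copy of size \<open>t\<close> at \<open>(d k, 0)\<close>.
\<close>

lemma exists_form_near_vertex:
  assumes "d \<ge> 1"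
  obtains F where "F \<in> forms (d * t\<^sup>2)" "F \<noteq> 0"
    "\<And>i j. \<lbrakk>acoef \<xi> F i j \<noteq> 0; i + d\<^sup>2 * j \<le> d\<^sup>2 * t\<^sup>2\<rbrakk> \<Longrightarrow> d\<^sup>2 * t\<^sup>2 \<le> i + d\<^sup>2 * t"
proof -
  define D where "D = d\<^sup>2"
  define q where "q = t\<^sup>2"
  define A where "A = {(i, j) \<in> lattice_triangle D q. i + D * t < D * q}"
  have D: "D \<ge> 1" using assms by (simp add: D_def)
  have "t \<le> q" unfolding q_def by (cases t) (auto simp: power2_eq_square)
  then have "card A + card (lattice_triangle D t) = card (lattice_triangle D q)"
    unfolding A_def by (rule card_lattice_triangle_without_corner[OF D])
  then have "2 * card A + (t + 1) * (D * t + 2) = (q + 1) * (D * q + 2)"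
    using card_lattice_triangle[OF D, of q] card_lattice_triangle[OF D, of t] by simp
  moreover have "(q + 1) * (D * q + 2) < (d * q + 1) * (d * q + 2) + (t + 1) * (D * t + 2)"
  proof -
    have "q \<le> d * q" using assms by simp
    then have "2 * q < 3 * (d * q) + 2 * t + D * t + 2" by linarith
    then show ?thesis by (simp add: D_def q_def power2_eq_square algebra_simps)
  qed
  ultimately have card: "card A < form.dim (forms (d * q))"
    using dim_forms[of "d * q"] by simp
  have "finite A"
    by (rule finite_subset[OF _ finite_lattice_triangle[OF D, of q]]) (auto simp: A_def)
  moreover have "forms (d * q) \<subseteq> form.span (monomial_basis (d * q))"
    by (simp add: span_monomial_basis)
  ultimately obtain F where F: "F \<in> forms (d * q)" "F \<noteq> 0"
      "\<And>p. p \<in> A \<Longrightarrow> acoef \<xi> F (fst p) (snd p) = 0"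
    using card form.exists_common_zero[of A "\<lambda>p F. acoef \<xi> F (fst p) (snd p)",
        OF _ linear_acoef subspace_forms _ finite_monomial_basis]
    by metis
  have "D * q \<le> i + D * t" if "acoef \<xi> F i j \<noteq> 0" "i + D * j \<le> D * q" for i j
  proof (rule ccontr)
    assume "\<not> ?thesis"
    then have "(i, j) \<in> A" using that(2) by (simp add: A_def lattice_triangle_def)
    then show False using F(3) that(1) by force
  qed
  with F(1,2) show ?thesis unfolding D_def q_def by (intro that)
qed

subsection \<open>Exponents selected by the two valuations\<close>

lemma finite_weight_sublevel:
  assumes "s > 0"
  shows "finite {(i, j). real i + s * real j \<le> c}"
proof (rule finite_subset)
  show "{(i, j). real i + s * real j \<le> c} \<subseteq> {..nat \<lfloor>c\<rfloor>} \<times> {..nat \<lfloor>c / s\<rfloor>}"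
  proof clarify
    fix i j assume le: "real i + s * real j \<le> c"
    moreover have "0 \<le> s * real j" using assms by simp
    ultimately have "real i \<le> c" by linarith
    moreover have "real j \<le> c / s"
      using le assms by (simp add: pos_le_divide_eq mult.commute)
    ultimately show "i \<in> {..nat \<lfloor>c\<rfloor>} \<and> j \<in> {..nat \<lfloor>c / s\<rfloor>}"
      by (simp add: le_nat_floor)
  qed
qed simp

lemma v1_attained:
  assumes "s > 0" and nm: "acoef \<xi> F n m \<noteq> 0"
  obtains i j where "acoef \<xi> F i j \<noteq> 0" "v1 \<xi> s F = real i + s * real j"
    "\<And>i' j'. acoef \<xi> F i' j' \<noteq> 0 \<Longrightarrow> v1 \<xi> s F \<le> real i' + s * real j'"
proof -
  define \<phi> where "\<phi> = (\<lambda>(i, j). real i + s * real j)"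
  define A where "A = {(i, j). acoef \<xi> F i j \<noteq> 0 \<and> \<phi> (i, j) \<le> \<phi> (n, m)}"
  have "finite A"
    by (rule finite_subset[OF _ finite_weight_sublevel[OF \<open>s > 0\<close>, of "\<phi> (n, m)"]])
      (auto simp: A_def \<phi>_def)
  moreover have "(n, m) \<in> A" using nm by (simp add: A_def)
  ultimately obtain p where p: "p \<in> A" "\<And>x. x \<in> A \<Longrightarrow> \<phi> p \<le> \<phi> x"
    by (metis arg_min_if_finite(1) arg_min_least empty_iff)
  have p_min: "\<phi> p \<le> \<phi> (i, j)" if "acoef \<xi> F i j \<noteq> 0" for i j
    using that p(1) p(2)[of "(i, j)"] by (cases "(i, j) \<in> A") (auto simp: A_def)
  have "v1 \<xi> s F = \<phi> p"
    unfolding v1_def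
    by (rule cInf_eq_minimum) (use p(1) p_min in \<open>auto simp: A_def \<phi>_def\<close>)
  with p(1) p_min show ?thesis
    by (intro that[of "fst p" "snd p"]) (auto simp: A_def \<phi>_def)
qed

lemma vplus_attained:
  assumes "s > 0" and "acoef \<xi> F n m \<noteq> 0"
  obtains i j where "acoef \<xi> F i j \<noteq> 0" "vplus \<xi> s F = (real i + s * real j, real j)"
    "\<And>i' j'. acoef \<xi> F i' j' \<noteq> 0 \<Longrightarrow> real i + s * real j \<le> real i' + s * real j'"
proof -
  define R where "R j \<longleftrightarrow> (\<exists>i. acoef \<xi> F i j \<noteq> 0 \<and> real i + s * real j = v1 \<xi> s F)" for j
  define j where "j = (LEAST j. R j)"
  have "\<exists>j. R j" using v1_attained[OF assms] by (metis R_def)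
  then have "R j" unfolding j_def by (rule LeastI_ex)
  then obtain i where i: "acoef \<xi> F i j \<noteq> 0" "real i + s * real j = v1 \<xi> s F"
    by (auto simp: R_def)
  have "Inf {real j |j. R j} = real j"
    by (rule cInf_eq_minimum) (use \<open>R j\<close> Least_le[of R] in \<open>auto simp: j_def\<close>)
  then have "vplus \<xi> s F = (real i + s * real j, real j)"
    by (simp add: vplus_def R_def i(2))
  moreover have "real i + s * real j \<le> real i' + s * real j'" if "acoef \<xi> F i' j' \<noteq> 0" for i' j'
    using that i(2) v1_attained[OF assms] by metis
  ultimately show ?thesis using that i(1) by blast
qed

locale plane_branch =
  fixes G :: "complex poly poly poly" and d :: nat and \<xi> :: "complex fps"
  assumes G_in_forms: "G \<in> forms d"
    and irreducible_G: "irreducible G"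
    and smooth: "hcoeff G 0 1 (d - 1) \<noteq> 0"
    and branch_origin: "\<xi> $ 0 = 0"
    and branch_on_curve: "restrict_to_branch \<xi> G = 0"
begin

lemma d_pos: "d \<ge> 1"
proof -
  have "0 + 1 + (d - 1) = d" using G_in_forms smooth unfolding forms_iff by blast
  then show ?thesis by linarith
qed

lemma prime_elem_G: "prime_elem G"
  using irreducible_G by (rule irreducible_imp_prime_elem)

lemma G_nonzero: "G \<noteq> 0"
  using prime_elem_G by auto

lemma factor_out_curve:
  assumes "F \<in> forms k" "F \<noteq> 0"
  obtains m H where "F = G ^ m * H" "m * d \<le> k" "restrict_to_branch \<xi> H \<noteq> 0"
    "subdegree (restrict_to_branch \<xi> H) \<le> d * (k - m * d)"
proof -
  define m where "m = multiplicity G F"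
  obtain H where H: "F = G ^ m * H" "\<not> G dvd H"
    using multiplicity_decompose'[of F G] assms(2) prime_elem_G by (auto simp: m_def)
  then have "m * d \<le> k" "H \<in> forms (k - m * d)"
    using cofactor_in_forms[of "G ^ m" H k "m * d"] assms power_in_forms[OF G_in_forms] by auto
  then show ?thesis
    using that H branch_multiplicity_le[OF prime_elem_G G_in_forms branch_on_curve] by blast
qed

definition branch_cofactor :: "complex fps fps" where
  "branch_cofactor = fps_shift 1 (cexp \<xi> G)"

lemma cexp_G: "cexp \<xi> G = fps_X * branch_cofactor"
  using branch_on_curve by (intro fps_ext) (simp add: branch_cofactor_def restrict_to_branch_def)

lemma branch_cofactor_0_0_nonzero: "branch_cofactor $ 0 $ 0 \<noteq> 0"
proof -
  have "coeff (coeff G 0) 1 = monom (hcoeff G 0 1 (d - 1)) (d - 1)"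
    using hcoeff_eq_0_if_forms[OF G_in_forms, of 0 1] by (intro poly_eqI) (auto simp: hcoeff_def)
  then have "acoef \<xi> G 0 1 = hcoeff G 0 1 (d - 1)"
    by (simp add: acoef_0_left[OF branch_origin] poly_monom)
  then show ?thesis using smooth by (simp add: branch_cofactor_def acoef_def)
qed

lemma nth_cexp_G_power_mult:
  "(cexp \<xi> G ^ m * h) $ j = (if j < m then 0 else (branch_cofactor ^ m * h) $ (j - m))"
  by (simp add: cexp_G power_mult_distrib mult.assoc fps_X_power_mult_nth)

lemma subdegree_nth_cexp_G_power_mult:
  assumes "h $ 0 \<noteq> 0"
  shows "(cexp \<xi> G ^ m * h) $ m \<noteq> 0"
    and "subdegree ((cexp \<xi> G ^ m * h) $ m) = subdegree (h $ 0)"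
proof -
  have eq: "(cexp \<xi> G ^ m * h) $ m = (branch_cofactor $ 0) ^ m * h $ 0"
    by (simp add: nth_cexp_G_power_mult fps_power_zeroth)
  have "branch_cofactor $ 0 \<noteq> 0" "subdegree (branch_cofactor $ 0) = 0"
    using branch_cofactor_0_0_nonzero by auto
  then show "(cexp \<xi> G ^ m * h) $ m \<noteq> 0"
    "subdegree ((cexp \<xi> G ^ m * h) $ m) = subdegree (h $ 0)"
    using assms by (simp_all add: eq)
qed

lemma flag_val_eq:
  assumes F: "cexp \<xi> F = cexp \<xi> G ^ m * h" and "h $ 0 \<noteq> 0"
  shows "flag_val \<xi> G F = (real m, real (subdegree (h $ 0)))"
proof -
  have ord: "ord_C \<xi> G F = m"
    unfolding ord_C_def
  proof (rule Greatest_equality)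
    fix l assume "cexp \<xi> G ^ l dvd cexp \<xi> F"
    then obtain q where "cexp \<xi> F = cexp \<xi> G ^ l * q" by auto
    with F subdegree_nth_cexp_G_power_mult(1)[OF assms(2)] show "l \<le> m"
      by (metis nth_cexp_G_power_mult not_le)
  qed (simp add: F)
  have "cexp \<xi> G \<noteq> 0" using branch_cofactor_0_0_nonzero by (auto simp: cexp_G)
  then have "(SOME h'. cexp \<xi> F = cexp \<xi> G ^ m * h') = h"
    by (intro some_equality) (simp_all add: F)
  then show ?thesis by (simp add: flag_val_def ord)
qed

lemma flag_val_lexicographically_least:
  assumes "F \<in> forms k" "F \<noteq> 0"
  obtains n m where "flag_val \<xi> G F = (real m, real n)" "acoef \<xi> F n m \<noteq> 0"
    "n + d\<^sup>2 * m \<le> d * k" "\<And>i j. acoef \<xi> F i j \<noteq> 0 \<Longrightarrow> m \<le> j"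
proof -
  obtain m H where H: "F = G ^ m * H" "m * d \<le> k" "restrict_to_branch \<xi> H \<noteq> 0"
      "subdegree (restrict_to_branch \<xi> H) \<le> d * (k - m * d)"
    using factor_out_curve[OF assms] by blast
  define n where "n = subdegree (restrict_to_branch \<xi> H)"
  have cexp_F: "cexp \<xi> F = cexp \<xi> G ^ m * cexp \<xi> H"
    by (simp add: H(1) cexp.hom_mult cexp.hom_power)
  have cexp_H: "cexp \<xi> H $ 0 \<noteq> 0" "subdegree (cexp \<xi> H $ 0) = n"
    using H(3) by (simp_all add: restrict_to_branch_def n_def)
  note leading_coeff = subdegree_nth_cexp_G_power_mult[OF cexp_H(1), of m, folded cexp_F]
  have "acoef \<xi> F n m \<noteq> 0"
    using leading_coeff cexp_H(2) by (metis acoef_def nth_subdegree_nonzero)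
  moreover have "n + d\<^sup>2 * m \<le> d * k"
  proof -
    have "d * (k - m * d) + d\<^sup>2 * m = d * k"
      using H(2) by (simp add: power2_eq_square mult.assoc mult.commute[of m d] flip: distrib_left)
    with H(4) show ?thesis by (simp add: n_def)
  qed
  moreover have "m \<le> j" if "acoef \<xi> F i j \<noteq> 0" for i j
    using that by (auto simp: acoef_def cexp_F nth_cexp_G_power_mult split: if_splits)
  ultimately show ?thesis
    using that flag_val_eq[OF cexp_F cexp_H(1)] cexp_H(2) by blast
qed

text \<open>The value of a term \<open>x ^ i w ^ j\<close> is \<open>(j, i)\<close>, in the order of the flag valuation.\<close>

definition selects_exponents :: "(complex poly poly poly \<Rightarrow> real \<times> real) \<Rightarrow> bool" where
  "selects_exponents w \<longleftrightarrow> (\<forall>k. \<forall>F \<in> forms k - {0}.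
     \<exists>i j. w F = (real j, real i) \<and> acoef \<xi> F i j \<noteq> 0 \<and> i + d\<^sup>2 * j \<le> d * k)"

lemma selects_exponents_flag_val: "selects_exponents (flag_val \<xi> G)"
  unfolding selects_exponents_def
  by (metis DiffE flag_val_lexicographically_least singletonI)

lemma selects_exponents_vplus:
  assumes s: "s \<ge> (real d)\<^sup>2"
  shows "selects_exponents (\<lambda>F. (\<lambda>(t, u). (u, t - s * u)) (vplus \<xi> s F))"
  unfolding selects_exponents_def
proof (intro allI ballI)
  fix k F assume "F \<in> forms k - {0}"
  then obtain n m where nm: "acoef \<xi> F n m \<noteq> 0" "n + d\<^sup>2 * m \<le> d * k"
      "\<And>i j. acoef \<xi> F i j \<noteq> 0 \<Longrightarrow> m \<le> j"
    by (metis DiffE flag_val_lexicographically_least singletonI)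
  have "1 \<le> (real d)\<^sup>2" using d_pos by simp
  then have "s > 0" using s by linarith
  then obtain i j where ij: "acoef \<xi> F i j \<noteq> 0" "vplus \<xi> s F = (real i + s * real j, real j)"
      "real i + s * real j \<le> real n + s * real m"
    using vplus_attained[OF _ nm(1)] nm(1) by metis
  have "(s - (real d)\<^sup>2) * real m \<le> (s - (real d)\<^sup>2) * real j"
    using s nm(3)[OF ij(1)] by (intro mult_left_mono) auto
  with ij(3) have "real (i + d\<^sup>2 * j) \<le> real (n + d\<^sup>2 * m)"
    by (simp add: algebra_simps)
  then have "i + d\<^sup>2 * j \<le> n + d\<^sup>2 * m" by (simp only: of_nat_le_iff)
  with nm(2) have "i + d\<^sup>2 * j \<le> d * k" by linarith
  with ij(1,2) show "\<exists>i j. (\<lambda>(t, u). (u, t - s * u)) (vplus \<xi> s F) = (real j, real i)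
      \<and> acoef \<xi> F i j \<noteq> 0 \<and> i + d\<^sup>2 * j \<le> d * k"
    by (intro exI[of _ i] exI[of _ j]) simp
qed

end

subsection \<open>The convex bodies\<close>

definition value_body :: "(complex poly poly poly \<Rightarrow> real \<times> real) \<Rightarrow> (real \<times> real) set" where
  "value_body w = closure (convex hull
     {(1 / real k) *\<^sub>R w F | k F. k \<ge> 1 \<and> F \<noteq> 0 \<and> homogeneous_deg F k})"

lemma Delta_s_plus_eq_value_body: "Delta_s_plus \<xi> s = value_body (vplus \<xi> s)"
  by (simp add: Delta_s_plus_def value_body_def)

lemma NO_body_eq_value_body: "NO_body \<xi> G = value_body (flag_val \<xi> G)"
  by (simp add: NO_body_def value_body_def)

lemma value_body_linear_image:
  assumes "linear L" "inj L"
  shows "value_body (\<lambda>F. L (w F)) = L ` value_body w"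
proof -
  have "{(1 / real k) *\<^sub>R L (w F) | k F. k \<ge> 1 \<and> F \<noteq> 0 \<and> homogeneous_deg F k} =
      L ` {(1 / real k) *\<^sub>R w F | k F. k \<ge> 1 \<and> F \<noteq> 0 \<and> homogeneous_deg F k}"
    unfolding linear_scale[OF assms(1), symmetric] by blast
  then show ?thesis
    by (simp only: value_body_def closure_injective_linear_image[OF assms]
        convex_hull_linear_image[OF assms(1)])
qed

lemma normalized_value_in_value_body:
  "\<lbrakk>k \<ge> 1; F \<in> forms k; F \<noteq> 0\<rbrakk> \<Longrightarrow> (1 / real k) *\<^sub>R w F \<in> value_body w"
  unfolding value_body_def forms_def
  by (intro subsetD[OF closure_subset] hull_inc) blast

lemma value_body_subset:
  assumes "closed T" "convex T"
    and "\<And>k F. \<lbrakk>k \<ge> 1; F \<in> forms k; F \<noteq> 0\<rbrakk> \<Longrightarrow> (1 / real k) *\<^sub>R w F \<in> T"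
  shows "value_body w \<subseteq> T"
  unfolding value_body_def using assms
  by (intro closure_minimal hull_minimal) (auto simp: forms_def)

lemma closed_value_body: "closed (value_body w)"
  by (simp add: value_body_def)

lemma convex_value_body: "convex (value_body w)"
  by (simp add: value_body_def)

lemma closed_tri: "closed (tri a b c)"
  unfolding tri_def by (intro compact_imp_closed finite_imp_compact_convex_hull) simp

lemma convex_tri: "convex (tri a b c)"
  by (simp add: tri_def)

lemma right_triangle_memI:
  assumes "a > 0" "c > 0" "x \<ge> 0" "y \<ge> 0" "x / a + y / c \<le> 1"
  shows "(x, y) \<in> tri a 0 c"
  unfolding tri_def convex_hull_3
  by (intro CollectI exI[of _ "1 - x / a - y / c"] exI[of _ "x / a"] exI[of _ "y / c"])
    (use assms in auto)

context plane_branch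
begin

lemma selected_exponent:
  assumes "selects_exponents w" "F \<in> forms k" "F \<noteq> 0"
  obtains i j where "w F = (real j, real i)" "acoef \<xi> F i j \<noteq> 0" "i + d\<^sup>2 * j \<le> d * k"
  using assms unfolding selects_exponents_def by (metis DiffI singletonD)

lemma value_body_subset_tri:
  assumes "selects_exponents w"
  shows "value_body w \<subseteq> tri (1 / real d) 0 (real d)"
proof (rule value_body_subset[OF closed_tri convex_tri])
  fix k F assume k: "k \<ge> 1" and F: "F \<in> forms k" "F \<noteq> 0"
  obtain i j where ij: "w F = (real j, real i)" "i + d\<^sup>2 * j \<le> d * k"
    using selected_exponent[OF assms F] by blast
  have "real j / real k / (1 / real d) + real i / real k / real d =
      real (i + d\<^sup>2 * j) / real (d * k)"
    using k d_pos by (simp add: add_divide_distrib power2_eq_square mult.commute)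
  also have "\<dots> \<le> 1"
    using of_nat_mono[OF ij(2), where ?'a = real] k d_pos by (subst divide_le_eq_1_pos) simp_all
  finally have "real j / real k / (1 / real d) + real i / real k / real d \<le> 1" .
  then show "(1 / real k) *\<^sub>R w F \<in> tri (1 / real d) 0 (real d)"
    using k d_pos by (auto simp: ij(1) intro!: right_triangle_memI)
qed

lemma origin_in_value_body:
  assumes "selects_exponents w"
  shows "(0, 0) \<in> value_body w"
proof -
  define Z where "Z = hmonom 0 0 1"
  have "hcoeff Z 0 0 1 \<noteq> 0" by (simp add: Z_def hcoeff_hmonom)
  then have Z: "Z \<in> forms 1" "Z \<noteq> 0" by (auto simp: Z_def hmonom_in_forms)
  obtain i j where ij: "w Z = (real j, real i)" "acoef \<xi> Z i j \<noteq> 0"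
    using selected_exponent[OF assms Z] by blast
  have "i = 0 \<and> j = 0"
    using ij(2) by (auto simp: Z_def acoef_def cexp_hmonom split: if_splits)
  with ij(1) normalized_value_in_value_body[of 1 Z w] Z show ?thesis
    by (simp add: zero_prod_def)
qed

lemma curve_vertex_in_value_body:
  assumes "selects_exponents w"
  shows "(1 / real d, 0) \<in> value_body w"
proof -
  obtain i j where ij: "w G = (real j, real i)" "acoef \<xi> G i j \<noteq> 0" "i + d\<^sup>2 * j \<le> d * d"
    using selected_exponent[OF assms G_in_forms G_nonzero] by blast
  have "j \<noteq> 0" using ij(2) branch_on_curve by (cases j) (auto simp: acoef_0_right)
  moreover have "d\<^sup>2 * j \<le> d\<^sup>2 * 1" using ij(3) unfolding power2_eq_square by linarith
  ultimately have "j = 1" using d_pos by simp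
  with ij(3) have "i = 0" by (simp add: power2_eq_square)
  then show ?thesis
    using normalized_value_in_value_body[OF d_pos G_in_forms G_nonzero, of w] ij(1) \<open>j = 1\<close> by simp
qed

lemma value_near_branch_vertex:
  assumes "selects_exponents w" "t \<ge> 1"
  obtains x y where "(x, y) \<in> value_body w" "0 \<le> x"
    "real d - real d / real t \<le> y" "(real d)\<^sup>2 * x + y \<le> real d"
proof -
  obtain F where F: "F \<in> forms (d * t\<^sup>2)" "F \<noteq> 0"
    "\<And>i j. \<lbrakk>acoef \<xi> F i j \<noteq> 0; i + d\<^sup>2 * j \<le> d\<^sup>2 * t\<^sup>2\<rbrakk> \<Longrightarrow> d\<^sup>2 * t\<^sup>2 \<le> i + d\<^sup>2 * t"
    using exists_form_near_vertex[OF d_pos] by blast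
  obtain i j where ij: "w F = (real j, real i)" "acoef \<xi> F i j \<noteq> 0" "i + d\<^sup>2 * j \<le> d\<^sup>2 * t\<^sup>2"
    using selected_exponent[OF assms(1) F(1,2)] by (metis mult.assoc power2_eq_square)
  define k where "k = real d * (real t)\<^sup>2"
  have pos: "real d > 0" "real t > 0" "k > 0" using d_pos assms(2) by (simp_all add: k_def)
  have "(1 / k) *\<^sub>R w F \<in> value_body w"
    using normalized_value_in_value_body[OF _ F(1,2), of w] d_pos assms(2) by (simp add: k_def)
  then have "(real j / k, real i / k) \<in> value_body w" by (simp add: ij(1))
  moreover have "real d - real d / real t \<le> real i / k"
  proof -
    have "real (d\<^sup>2 * t\<^sup>2) \<le> real (i + d\<^sup>2 * t)"
      using F(3)[OF ij(2,3)] by (simp only: of_nat_le_iff)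
    then show ?thesis using pos by (simp add: k_def field_simps power2_eq_square)
  qed
  moreover have "(real d)\<^sup>2 * (real j / k) + real i / k \<le> real d"
  proof -
    have "(real d)\<^sup>2 * (real j / k) + real i / k = real (i + d\<^sup>2 * j) / k"
      by (simp add: add_divide_distrib)
    also have "\<dots> \<le> real (d\<^sup>2 * t\<^sup>2) / k"
      using ij(3) pos(3) by (intro divide_right_mono of_nat_mono) simp_all
    also have "\<dots> = real d" using pos by (simp add: k_def power2_eq_square)
    finally show ?thesis .
  qed
  ultimately show ?thesis using that pos by simp
qed

lemma branch_vertex_in_value_body:
  assumes "selects_exponents w"
  shows "(0, real d) \<in> value_body w"
proof -
  have "\<exists>x y. (x, y) \<in> value_body w \<and> 0 \<le> x \<and> real d - real d / real (Suc n) \<le> y \<and>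
      (real d)\<^sup>2 * x + y \<le> real d" for n
    using value_near_branch_vertex[OF assms, of "Suc n"] by (metis One_nat_def Suc_le_mono le0)
  then obtain x y where xy: "\<And>n. (x n, y n) \<in> value_body w" "\<And>n. 0 \<le> x n"
      "\<And>n. real d - real d / real (Suc n) \<le> y n" "\<And>n. (real d)\<^sup>2 * x n + y n \<le> real d"
    by metis
  have lim: "(\<lambda>n. real d / real (Suc n)) \<longlonglongrightarrow> 0"
    by (rule LIMSEQ_Suc[OF lim_const_over_n])
  have "y \<longlonglongrightarrow> real d"
  proof (rule tendsto_sandwich)
    show "(\<lambda>n. real d - real d / real (Suc n)) \<longlonglongrightarrow> real d"
      using tendsto_diff[OF tendsto_const lim] by simp
    have "y n \<le> real d" for n
    proof -
      have "0 \<le> (real d)\<^sup>2 * x n" using xy(2) by simp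
      with xy(4)[of n] show ?thesis by linarith
    qed
    then show "\<forall>\<^sub>F n in sequentially. y n \<le> real d" by simp
  qed (use xy(3) in auto)
  moreover have "x \<longlonglongrightarrow> 0"
  proof (rule tendsto_sandwich[OF _ _ tendsto_const lim])
    have "x n \<le> real d / real (Suc n)" for n
    proof -
      have "1 * x n \<le> (real d)\<^sup>2 * x n"
        using xy(2) d_pos by (intro mult_right_mono) simp_all
      with xy(3,4)[of n] show ?thesis by linarith
    qed
    then show "\<forall>\<^sub>F n in sequentially. x n \<le> real d / real (Suc n)" by simp
  qed (use xy(2) in simp)
  ultimately have "(\<lambda>n. (x n, y n)) \<longlonglongrightarrow> (0, real d)" by (intro tendsto_Pair)
  then show ?thesis
    using closed_value_body xy(1) by (rule closed_sequentially[rotated 2])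
qed

theorem value_body_eq_tri:
  assumes "selects_exponents w"
  shows "value_body w = tri (1 / real d) 0 (real d)"
proof
  show "value_body w \<subseteq> tri (1 / real d) 0 (real d)"
    using assms by (rule value_body_subset_tri)
  show "tri (1 / real d) 0 (real d) \<subseteq> value_body w"
    unfolding tri_def
    using assms origin_in_value_body curve_vertex_in_value_body branch_vertex_in_value_body
    by (intro hull_minimal convex_value_body) auto
qed

end

theorem theorem5p11:
  fixes G :: "complex poly poly poly" and d :: nat and \<xi> :: "complex fps" and s :: real
  assumes "homogeneous_deg G d" and "irreducible G"
    and "hcoeff G 0 0 d = 0"
    and "hcoeff G 0 1 (d - 1) \<noteq> 0"
    and "hcoeff G 1 0 (d - 1) = 0"
    and "fps_nth \<xi> 0 = 0" and "fps_nth \<xi> 1 = 0"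
    and "fps_nth (cexp \<xi> G) 0 = 0"
    and "s \<in> \<rat>" and "s \<ge> real d ^ 2"
  shows "Delta_s_plus \<xi> s = tri (real d) (s / real d) (1 / real d)
    \<and> NO_body \<xi> G = tri (1 / real d) 0 (real d)
    \<and> NO_body \<xi> G = (\<lambda>(t, u). (u, t - s * u)) ` Delta_s_plus \<xi> s"
proof -
  interpret plane_branch G d \<xi>
    using assms by unfold_locales (auto simp: forms_def restrict_to_branch_def)
  let ?A = "\<lambda>(t, u). (u, t - s * u)" and ?B = "\<lambda>(u, t). (t + s * u, u)"
  have linear: "linear ?A" "linear ?B" and inverse: "\<And>p. ?B (?A p) = p"
    by (auto intro!: linearI simp: algebra_simps)
  from inverse have inj: "inj ?A" by (rule inj_on_inverseI)
  have NO: "NO_body \<xi> G = tri (1 / real d) 0 (real d)"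
    unfolding NO_body_eq_value_body by (rule value_body_eq_tri[OF selects_exponents_flag_val])
  have A_Delta: "?A ` Delta_s_plus \<xi> s = tri (1 / real d) 0 (real d)"
    using value_body_linear_image[OF linear(1) inj, of "vplus \<xi> s"]
      value_body_eq_tri[OF selects_exponents_vplus[OF assms(10)]]
    by (simp add: Delta_s_plus_eq_value_body)
  have "Delta_s_plus \<xi> s = ?B ` ?A ` Delta_s_plus \<xi> s"
    by (simp add: image_image inverse)
  also have "\<dots> = tri (real d) (s / real d) (1 / real d)"
    unfolding A_Delta tri_def convex_hull_linear_image[OF linear(2)] by (simp add: insert_commute)
  finally show ?thesis using NO A_Delta by simp
qed

end
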